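(* Let $n \geq 1$, let $\mathcal{A}_n$ be uniformly distributed on $\mathcal{M}(n,2)$, and let $h : \mathcal{M}(n,2) \to \mathbb{R}$ be a function for which there exists $h^* : \mathbb{Z}_{\geq 0}^n \to \mathbb{R}$ with $h(A) = h^*(\chi_1(A), \ldots, \chi_n(A))$ for all $A \in \mathcal{M}(n,2)$. Let $\Pi$ be uniformly distributed on the symmetric group $\mathscr{S}_n$. Then $$\mathbb{E}\, h(\mathcal{A}_n) = \dfrac{(n!)^2}{H(n,2)}\, \mathbb{E}\left[ h^*(c_1(\Pi), \ldots, c_n(\Pi))\, 2^{-C(\Pi) + c_1(\Pi)} \right].$$ In particular, $$\mathbb{E}\left[2^{-C(\Pi) + c_1(\Pi)}\right] = \dfrac{H(n,2)}{(n!)^2},$$ and hence $$\mathbb{E}\, h(\mathcal{A}_n) = \dfrac{\mathbb{E}\left[ h^*(c_1(\Pi), \ldots, c_n(\Pi))\, 2^{-C(\Pi) + c_1(\Pi)} \right]}{\mathbb{E}\left[2^{-C(\Pi) + c_1(\Pi)}\right]}.$$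
   Context: For $n \geq 1$, $\mathcal{M}(n,2)$ is the (finite) set of $n \times n$ matrices $A = (a_{ij})$ with non-negative integer entries all of whose row sums and column sums equal $2$, and $H(n,2)$ is its cardinality. Each $A \in \mathcal{M}(n,2)$ is identified with the labelled $2$-regular bipartite multigraph $G_A$ on vertices $\{R_1,\ldots,R_n\} \cup \{C_1,\ldots,C_n\}$ having exactly $a_{ij}$ edges between $R_i$ and $C_j$. A $k$-component of $A$ is a pair $(S,T)$ of non-empty subsets of $\{1,\ldots,n\}$ with $|S| = |T| = k$ such that the submatrix $(a_{ij})_{i\in S, j \in T}$ has all row and column sums equal to $2$. A component is irreducible if no other component $(S',T') \neq (S,T)$ satisfies $S' \subseteq S$, $T' \subseteq T$. $\chi_k(A)$ denotes the number of irreducible $k$-components of $A$, equivalently the number of connected components of $G_A$ having exactly $2k$ vertices. $\mathscr{S}_n$ is the symmetric group of all permutations of $\{1,\ldots,n\}$. For $\pi \in \mathscr{S}_n$, $c_i(\pi)$ is the number of cycles of length $i$ of $\pi$ (fixed points being cycles of length $1$), and $C(\pi) = \sum_{i=1}^n c_i(\pi)$ is the total number of cycles. *)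

theory Defs
  imports "HOL-Probability.Probability" "HOL-Combinatorics.Orbits"
begin

text \<open>
  An \<open>n \<times> n\<close> matrix is a function on pairs of indices in \<open>{1..n}\<close>, set to \<open>0\<close> elsewhere so that
  matrices correspond to functions one-to-one.
\<close>

definition two_regular_matrices :: "nat \<Rightarrow> (nat \<Rightarrow> nat \<Rightarrow> nat) set" where
  "two_regular_matrices n = {A.
     (\<forall>i j. i \<notin> {1..n} \<or> j \<notin> {1..n} \<longrightarrow> A i j = 0) \<and>
     (\<forall>i\<in>{1..n}. (\<Sum>j\<in>{1..n}. A i j) = 2) \<and>
     (\<forall>j\<in>{1..n}. (\<Sum>i\<in>{1..n}. A i j) = 2)}"

definition H2 :: "nat \<Rightarrow> nat" where
  "H2 n = card (two_regular_matrices n)"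

definition k_component ::
    "nat \<Rightarrow> (nat \<Rightarrow> nat \<Rightarrow> nat) \<Rightarrow> nat \<Rightarrow> nat set \<times> nat set \<Rightarrow> bool" where
  "k_component n A k = (\<lambda>(S, T).
     S \<noteq> {} \<and> T \<noteq> {} \<and> S \<subseteq> {1..n} \<and> T \<subseteq> {1..n} \<and> card S = k \<and> card T = k \<and>
     (\<forall>i\<in>S. (\<Sum>j\<in>T. A i j) = 2) \<and> (\<forall>j\<in>T. (\<Sum>i\<in>S. A i j) = 2))"

definition irreducible_k_component ::
    "nat \<Rightarrow> (nat \<Rightarrow> nat \<Rightarrow> nat) \<Rightarrow> nat \<Rightarrow> nat set \<times> nat set \<Rightarrow> bool" where
  "irreducible_k_component n A k = (\<lambda>(S, T).
     k_component n A k (S, T) \<and>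
     \<not> (\<exists>l S' T'. k_component n A l (S', T') \<and> (S', T') \<noteq> (S, T) \<and> S' \<subseteq> S \<and> T' \<subseteq> T))"

definition chi :: "nat \<Rightarrow> nat \<Rightarrow> (nat \<Rightarrow> nat \<Rightarrow> nat) \<Rightarrow> nat" where
  "chi n k A = card {P. irreducible_k_component n A k P}"

text \<open>The cycles of a permutation are counted through their supports, which are its orbits.\<close>

definition cycle_count :: "nat \<Rightarrow> nat \<Rightarrow> (nat \<Rightarrow> nat) \<Rightarrow> nat" where
  "cycle_count n i p = card {X \<in> orbit p ` {1..n}. card X = i}"

definition total_cycles :: "nat \<Rightarrow> (nat \<Rightarrow> nat) \<Rightarrow> nat" where
  "total_cycles n p = (\<Sum>i = 1..n. cycle_count n i p)"

definition uniform_matrix :: "nat \<Rightarrow> (nat \<Rightarrow> nat \<Rightarrow> nat) pmf" where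
  "uniform_matrix n = pmf_of_set (two_regular_matrices n)"

definition uniform_permutation :: "nat \<Rightarrow> (nat \<Rightarrow> nat) pmf" where
  "uniform_permutation n = pmf_of_set {p. p permutes {1..n}}"

definition cycle_weight :: "nat \<Rightarrow> (nat \<Rightarrow> nat) \<Rightarrow> real" where
  "cycle_weight n p = 2 powi (- int (total_cycles n p) + int (cycle_count n 1 p))"

text \<open>
  \<^const>\<open>pmf_of_set\<close> is the uniform distribution only on finite non-empty sets; both sets used
  above qualify.
\<close>

lemma finite_two_regular_matrices: "finite (two_regular_matrices n)"
proof -
  let ?F = "{f. \<forall>x. (x \<in> {1..n} \<times> {1..n} \<longrightarrow> f x \<in> {0..2::nat}) \<and>
                     (x \<notin> {1..n} \<times> {1..n} \<longrightarrow> f x = 0)}"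
  have "finite ?F"
    by (intro finite_set_of_finite_funs) auto
  moreover have "two_regular_matrices n \<subseteq> curry ` ?F"
  proof
    fix A assume A: "A \<in> two_regular_matrices n"
    have "A i j \<le> 2" if "i \<in> {1..n}" "j \<in> {1..n}" for i j
    proof -
      have "A i j \<le> (\<Sum>j\<in>{1..n}. A i j)"
        using that by (intro member_le_sum) auto
      with A that show ?thesis by (simp add: two_regular_matrices_def)
    qed
    with A have "case_prod A \<in> ?F"
      by (auto simp: two_regular_matrices_def)
    then show "A \<in> curry ` ?F"
      by (rule image_eqI[rotated]) (simp only: curry_case_prod)
  qed
  ultimately show ?thesis
    by (rule finite_subset[rotated, OF finite_imageI])
qed

lemma two_regular_matrices_nonempty: "two_regular_matrices n \<noteq> {}"
proof -
  define A :: "nat \<Rightarrow> nat \<Rightarrow> nat"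
    where "A = (\<lambda>i j. if i = j then if i \<in> {1..n} then 2 else 0 else 0)"
  have "(\<Sum>j\<in>{1..n}. A i j) = 2" if "i \<in> {1..n}" for i
    using that by (simp add: A_def)
  moreover have "(\<Sum>i\<in>{1..n}. A i j) = 2" if "j \<in> {1..n}" for j
    using that by (simp add: A_def)
  moreover have "A i j = 0" if "i \<notin> {1..n} \<or> j \<notin> {1..n}" for i j
    using that by (auto simp: A_def)
  ultimately have "A \<in> two_regular_matrices n"
    unfolding two_regular_matrices_def by blast
  then show ?thesis by blast
qed

lemma finite_permutations_1n: "finite {p. p permutes {1..n::nat}}"
  by (simp add: finite_permutations)

lemma permutations_1n_nonempty: "{p. p permutes {1..n::nat}} \<noteq> {}"
  using permutes_id by blast

end

theory Submission
  imports Defs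
begin

text \<open>
  Every two-regular matrix is a sum \<open>P\<^sub>s + P\<^sub>t\<close> of two permutation matrices, and the proof counts
  pairs \<open>(s, t)\<close> of permutations in two ways. Read \<open>s\<close> and \<open>t\<close> as two perfect matchings from rows
  to columns: following a \<open>t\<close>-edge out of a row and an \<open>s\<close>-edge back carries out one step of the
  permutation \<open>\<pi> = s\<^sup>-\<^sup>1 \<circ> t\<close> of the rows, so the connected components of the multigraph are the
  cycles of \<open>\<pi>\<close>, a component with \<open>2 k\<close> vertices being a cycle of length \<open>k\<close>
  (\<open>irreducible_perm_sum_iff\<close>, \<open>chi_perm_sum\<close>).

  For a given matrix, the only freedom in choosing the pair is to exchange \<open>s\<close> and \<open>t\<close>
  independently on each component. On a component with \<open>k = 1\<close>, a double edge, the exchange changes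
  nothing; on all others it gives a new pair. Hence the matrix has exactly \<open>2\<^sup>C\<^sup>-\<^sup>c\<close> decompositions,
  where \<open>C\<close> is the number of cycles of \<open>\<pi>\<close> and \<open>c\<close> the number of its fixed points
  (\<open>card_decompositions\<close>); the weight \<open>cycle_weight\<close> is the reciprocal of this number
  (\<open>cycle_weight_eq\<close>).

  A sum over matrices therefore equals the sum over all pairs \<open>(s, t)\<close>, each weighted by
  \<open>cycle_weight\<close> of \<open>s\<^sup>-\<^sup>1 \<circ> t\<close>. For fixed \<open>s\<close> the permutation \<open>s\<^sup>-\<^sup>1 \<circ> t\<close> runs once through the symmetric
  group, which contributes the factor \<open>n!\<close> (\<open>sum_two_regular_matrices\<close>); the second factor \<open>n!\<close> of
  the theorem comes from averaging over permutations. That a decomposition exists at all is Hall's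
  theorem (\<open>hall_representatives\<close>), applied to the positions of the positive entries.
\<close>

section \<open>Systems of distinct representatives\<close>

text \<open>
  The step of Rado's proof of Hall's theorem: if both removals destroyed Hall's condition, at index
  sets \<open>insert i J\<close> and \<open>insert i K\<close>, then the unions over these two sets together cover the union
  over \<open>insert i (J \<union> K)\<close> (each restores the point that the other lost) and both contain the union
  over \<open>J \<inter> K\<close>. Adding the cardinalities contradicts Hall's condition for these two.
\<close>
lemma hall_shrink:
  assumes I: "finite I" and fin: "\<And>i. i \<in> I \<Longrightarrow> finite (X i)"
    and hall: "\<And>J. J \<subseteq> I \<Longrightarrow> card J \<le> card (\<Union> (X ` J))"
    and i: "i \<in> I" and xy: "x \<noteq> y"
  shows "\<exists>z\<in>{x, y}. \<forall>J\<subseteq>I. card J \<le> card (\<Union> ((X(i := X i - {z})) ` J))"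
proof (rule ccontr)
  assume neg: "\<not> ?thesis"
  have tight: "\<exists>J\<subseteq>I - {i}. card (\<Union> (X ` J) \<union> (X i - {z})) \<le> card J" if z: "z \<in> {x, y}" for z
  proof -
    obtain J where J: "J \<subseteq> I" "\<not> card J \<le> card (\<Union> ((X(i := X i - {z})) ` J))"
      using neg z by blast
    have "i \<in> J"
    proof (rule ccontr)
      assume "i \<notin> J"
      then have *: "(X(i := X i - {z})) ` J = X ` J" by auto
      show False using J hall[of J] unfolding * by blast
    qed
    then obtain L where L: "J = insert i L" "i \<notin> L" by (rule mk_disjoint_insert[THEN exE]) auto
    have "finite L" using J(1) L(1) I by (auto intro: finite_subset)
    have "(X(i := X i - {z})) ` L = X ` L" using L(2) by auto
    then have "\<Union> ((X(i := X i - {z})) ` J) = \<Union> (X ` L) \<union> (X i - {z})"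
      unfolding L(1) image_insert Sup_insert fun_upd_same by auto
    moreover have "card J = Suc (card L)" using \<open>finite L\<close> L by simp
    ultimately have "card (\<Union> (X ` L) \<union> (X i - {z})) \<le> card L" using J(2) by simp
    then show ?thesis using J(1) L by blast
  qed
  obtain J where J: "J \<subseteq> I - {i}" "card (\<Union> (X ` J) \<union> (X i - {x})) \<le> card J"
    using tight[of x] by blast
  obtain K where K: "K \<subseteq> I - {i}" "card (\<Union> (X ` K) \<union> (X i - {y})) \<le> card K"
    using tight[of y] by blast
  let ?P = "\<Union> (X ` J) \<union> (X i - {x})" and ?Q = "\<Union> (X ` K) \<union> (X i - {y})"
  have fJ: "finite J" and fK: "finite K"
    using J(1) K(1) I by (auto intro: finite_subset)
  have fP: "finite ?P" and fQ: "finite ?Q"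
    using J(1) K(1) fJ fK fin i by auto
  have "?P \<union> ?Q = \<Union> (X ` insert i (J \<union> K))" using xy by auto
  moreover have "card (insert i (J \<union> K)) = Suc (card (J \<union> K))"
    using J(1) K(1) fJ fK by (intro card_insert_disjoint) auto
  moreover have "card (insert i (J \<union> K)) \<le> card (\<Union> (X ` insert i (J \<union> K)))"
    using J(1) K(1) i by (intro hall) auto
  ultimately have un: "Suc (card (J \<union> K)) \<le> card (?P \<union> ?Q)" by simp
  have "card (J \<inter> K) \<le> card (\<Union> (X ` (J \<inter> K)))" using J(1) by (intro hall) auto
  also have "\<dots> \<le> card (?P \<inter> ?Q)" using fP by (intro card_mono) auto
  finally have "card (J \<inter> K) \<le> card (?P \<inter> ?Q)" .
  with un J(2) K(2) card_Un_Int[OF fP fQ] card_Un_Int[OF fJ fK] show False by linarith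
qed

text \<open>
  Shrinking sets that have two points ends, since the total size decreases, at singletons, and
  Hall's condition for pairs makes these distinct.
\<close>
lemma hall_representatives:
  assumes "finite I" "\<And>i. i \<in> I \<Longrightarrow> finite (X i)"
    and "\<And>J. J \<subseteq> I \<Longrightarrow> card J \<le> card (\<Union> (X ` J))"
  shows "\<exists>f. inj_on f I \<and> (\<forall>i\<in>I. f i \<in> X i)"
  using assms
proof (induction "\<Sum>i\<in>I. card (X i)" arbitrary: X rule: less_induct)
  case less
  note I = less.prems(1) and fin = less.prems(2) and hall = less.prems(3)
  show ?case
  proof (cases "\<forall>i\<in>I. card (X i) \<le> 1")
    case True
    have "\<exists>x. X i = {x}" if "i \<in> I" for i
    proof -
      have "1 \<le> card (X i)" using hall[of "{i}"] that by simp
      then show ?thesis using True that by (metis card_1_singletonE le_antisym)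
    qed
    then obtain f where f: "\<And>i. i \<in> I \<Longrightarrow> X i = {f i}" by metis
    have "inj_on f I"
    proof (rule inj_onI, rule ccontr)
      fix i j assume ij: "i \<in> I" "j \<in> I" "f i = f j" "i \<noteq> j"
      then have "\<Union> (X ` {i, j}) = {f i}" using f by auto
      with hall[of "{i, j}"] ij show False by simp
    qed
    with f show ?thesis by auto
  next
    case False
    then obtain i where i: "i \<in> I" "\<not> card (X i) \<le> Suc 0" by auto
    then obtain x y where xy: "x \<in> X i" "y \<in> X i" "x \<noteq> y"
      using fin by (auto simp: card_le_Suc0_iff_eq)
    obtain z where z: "z \<in> {x, y}"
        "\<And>J. J \<subseteq> I \<Longrightarrow> card J \<le> card (\<Union> ((X(i := X i - {z})) ` J))"
      using hall_shrink[OF I fin hall i(1) xy(3)] by blast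
    let ?Y = "X(i := X i - {z})"
    have zi: "z \<in> X i" using z(1) xy by auto
    have "(\<Sum>k\<in>I. card (?Y k)) < (\<Sum>k\<in>I. card (X k))"
    proof (rule sum_strict_mono_ex1[OF I])
      show "\<forall>k\<in>I. card (?Y k) \<le> card (X k)" by (auto intro: card_Diff1_le)
      show "\<exists>k\<in>I. card (?Y k) < card (X k)"
        using card_Diff1_less[OF fin[OF i(1)] zi] i(1) by (intro bexI[of _ i]) simp_all
    qed
    moreover have "finite (?Y k)" if "k \<in> I" for k using fin[OF that] by auto
    ultimately have "\<exists>f. inj_on f I \<and> (\<forall>k\<in>I. f k \<in> ?Y k)"
      using I z(2) by (intro less.hyps)
    then obtain f where f: "inj_on f I" "\<forall>k\<in>I. f k \<in> ?Y k" by blast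
    then have "\<forall>k\<in>I. f k \<in> X k" by (auto split: if_splits)
    with f(1) show ?thesis by blast
  qed
qed

section \<open>Two-regular matrices as sums of two permutation matrices\<close>

definition perm_sum :: "nat \<Rightarrow> (nat \<Rightarrow> nat) \<Rightarrow> (nat \<Rightarrow> nat) \<Rightarrow> nat \<Rightarrow> nat \<Rightarrow> nat" where
  "perm_sum n s t i j = (if i \<in> {1..n} then of_bool (s i = j) + of_bool (t i = j) else 0)"

lemma perm_sum_row:
  assumes "i \<in> {1..n}" "finite T"
  shows "(\<Sum>j\<in>T. perm_sum n s t i j) = of_bool (s i \<in> T) + of_bool (t i \<in> T)"
  using assms by (simp add: perm_sum_def sum.distrib of_bool_def)

lemma perm_sum_column:
  assumes s: "s permutes {1..n}" and t: "t permutes {1..n}" and S: "S \<subseteq> {1..n}"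
  shows "(\<Sum>i\<in>S. perm_sum n s t i j) = of_bool (j \<in> s ` S) + of_bool (j \<in> t ` S)"
proof -
  have *: "(\<Sum>i\<in>S. of_bool (p i = j)) = (of_bool (j \<in> p ` S) :: nat)"
    if "p permutes {1..n}" for p
  proof -
    have "p i = j \<longleftrightarrow> i = inv p j" for i
      using permutes_inv_eq[OF that, of j i] by auto
    then have "(\<Sum>i\<in>S. of_bool (p i = j)) = (\<Sum>i\<in>S. of_bool (i = inv p j) :: nat)"
      by simp
    also have "\<dots> = of_bool (inv p j \<in> S)"
      using finite_subset[OF S] by (simp add: of_bool_def)
    also have "inv p j \<in> S \<longleftrightarrow> j \<in> p ` S"
      using permutes_inverses[OF that] by (metis imageE imageI)
    finally show ?thesis .
  qed
  have "(\<Sum>i\<in>S. perm_sum n s t i j) = (\<Sum>i\<in>S. of_bool (s i = j) + of_bool (t i = j))"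
    using S by (intro sum.cong) (auto simp: perm_sum_def)
  then show ?thesis using *[OF s] *[OF t] by (simp add: sum.distrib)
qed

lemma perm_sum_two_regular:
  assumes s: "s permutes {1..n}" and t: "t permutes {1..n}"
  shows "perm_sum n s t \<in> two_regular_matrices n"
proof -
  have "perm_sum n s t i j = 0" if "i \<notin> {1..n} \<or> j \<notin> {1..n}" for i j
    using that permutes_in_image[OF s, of i] permutes_in_image[OF t, of i]
    by (auto simp: perm_sum_def)
  moreover have "(\<Sum>j\<in>{1..n}. perm_sum n s t i j) = 2" if "i \<in> {1..n}" for i
    using that permutes_in_image[OF s, of i] permutes_in_image[OF t, of i]
    by (subst perm_sum_row) auto
  moreover have "(\<Sum>i\<in>{1..n}. perm_sum n s t i j) = 2" if "j \<in> {1..n}" for j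
    using that permutes_image[OF s] permutes_image[OF t]
    by (subst perm_sum_column[OF s t]) auto
  ultimately show ?thesis unfolding two_regular_matrices_def by blast
qed

lemma inj_on_extend_permutes:
  assumes "inj_on f S" "f ` S \<subseteq> S" "finite S"
  shows "(\<lambda>i. if i \<in> S then f i else i) permutes S"
proof (rule bij_imp_permutes)
  have "f ` S = S" using assms by (metis endo_inj_surj)
  then have "bij_betw f S S" using assms by (simp add: bij_betw_def)
  then show "bij_betw (\<lambda>i. if i \<in> S then f i else i) S S"
    by (rule bij_betw_cong[THEN iffD1, rotated]) auto
qed auto

text \<open>
  Hall's condition holds by weighing: a set \<open>J\<close> of rows carries weight \<open>2 |J|\<close>, all of it in the
  columns that meet \<open>J\<close>, and each of these can hold at most \<open>2\<close>.
\<close>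
lemma two_regular_contains_permutation:
  assumes A: "A \<in> two_regular_matrices n"
  shows "\<exists>s. s permutes {1..n} \<and> (\<forall>i\<in>{1..n}. A i (s i) > 0)"
proof -
  have row: "(\<Sum>j\<in>{1..n}. A i j) = 2" if "i \<in> {1..n}" for i
    using A that by (auto simp: two_regular_matrices_def)
  have col: "(\<Sum>i\<in>{1..n}. A i j) = 2" if "j \<in> {1..n}" for j
    using A that by (auto simp: two_regular_matrices_def)
  define X where "X i = {j\<in>{1..n}. A i j > 0}" for i
  have "card J \<le> card (\<Union> (X ` J))" if J: "J \<subseteq> {1..n}" for J
  proof -
    let ?U = "\<Union> (X ` J)"
    have U: "?U \<subseteq> {1..n}" by (auto simp: X_def)
    have "2 * card J = (\<Sum>i\<in>J. \<Sum>j\<in>{1..n}. A i j)"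
      using J row by (simp add: subset_iff)
    also have "\<dots> = (\<Sum>i\<in>J. \<Sum>j\<in>?U. A i j)"
      using U by (intro sum.cong sum.mono_neutral_right) (auto simp: X_def)
    also have "\<dots> = (\<Sum>j\<in>?U. \<Sum>i\<in>J. A i j)" by (rule sum.swap)
    also have "\<dots> \<le> (\<Sum>j\<in>?U. \<Sum>i\<in>{1..n}. A i j)"
      using J by (intro sum_mono sum_mono2) auto
    also have "\<dots> = 2 * card ?U"
      using U col by (simp add: subset_iff)
    finally show ?thesis by simp
  qed
  then obtain f where f: "inj_on f {1..n}" "\<forall>i\<in>{1..n}. f i \<in> X i"
    using hall_representatives[of "{1..n}" X] by (auto simp: X_def)
  let ?s = "\<lambda>i. if i \<in> {1..n} then f i else i"
  have "?s permutes {1..n}"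
    using f by (intro inj_on_extend_permutes) (auto simp: X_def)
  moreover have "\<forall>i\<in>{1..n}. A i (?s i) > 0" using f(2) by (auto simp: X_def)
  ultimately show ?thesis by blast
qed

text \<open>
  Once a permutation matrix is subtracted, all line sums are \<open>1\<close>, and a non-negative integer matrix
  with that property is itself a permutation matrix.
\<close>
lemma two_regular_is_perm_sum:
  assumes A: "A \<in> two_regular_matrices n"
  shows "\<exists>s t. s permutes {1..n} \<and> t permutes {1..n} \<and> A = perm_sum n s t"
proof -
  have zero: "A i j = 0" if "i \<notin> {1..n} \<or> j \<notin> {1..n}" for i j
    using A that unfolding two_regular_matrices_def by blast
  have row: "(\<Sum>j\<in>{1..n}. A i j) = 2" if "i \<in> {1..n}" for i
    using A that by (auto simp: two_regular_matrices_def)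
  have col: "(\<Sum>i\<in>{1..n}. A i j) = 2" if "j \<in> {1..n}" for j
    using A that by (auto simp: two_regular_matrices_def)
  obtain s where s: "s permutes {1..n}" and pos: "\<And>i. i \<in> {1..n} \<Longrightarrow> A i (s i) > 0"
    using two_regular_contains_permutation[OF A] by blast
  define B where "B i j = A i j - of_bool (s i = j)" for i j
  have AB: "A i j = B i j + of_bool (s i = j)" if "i \<in> {1..n}" for i j
    using pos[OF that] by (auto simp: B_def)
  have rowB: "(\<Sum>j\<in>{1..n}. B i j) = 1" if i: "i \<in> {1..n}" for i
  proof -
    have "s i \<in> {1..n}" using i permutes_in_image[OF s, of i] by blast
    then have "(\<Sum>j\<in>{1..n}. A i j) = (\<Sum>j\<in>{1..n}. B i j) + 1"
      using i by (simp add: AB sum.distrib of_bool_def)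
    then show ?thesis using row[OF i] by simp
  qed
  have colB: "(\<Sum>i\<in>{1..n}. B i j) = 1" if j: "j \<in> {1..n}" for j
  proof -
    have "s i = j \<longleftrightarrow> i = inv s j" for i
      using permutes_inv_eq[OF s, of j i] by auto
    then have "(\<Sum>i\<in>{1..n}. of_bool (s i = j)) = (\<Sum>i\<in>{1..n}. of_bool (i = inv s j) :: nat)"
      by simp
    also have "\<dots> = 1"
      using j permutes_in_image[OF permutes_inv[OF s], of j] by (simp add: of_bool_def)
    finally have "(\<Sum>i\<in>{1..n}. A i j) = (\<Sum>i\<in>{1..n}. B i j) + 1"
      by (simp add: AB sum.distrib)
    then show ?thesis using col[OF j] by simp
  qed
  \<comment> \<open>a sum of natural numbers that equals 1 has a single non-zero term\<close>
  have "\<exists>j\<in>{1..n}. B i j = 1 \<and> (\<forall>k\<in>{1..n}. j \<noteq> k \<longrightarrow> B i k = 0)" if "i \<in> {1..n}" for i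
    using sum_eq_1_iff[of "{1..n}" "B i"] rowB[OF that] by blast
  then obtain f where f: "\<And>i. i \<in> {1..n} \<Longrightarrow> f i \<in> {1..n}" "\<And>i. i \<in> {1..n} \<Longrightarrow> B i (f i) = 1"
      "\<And>i k. i \<in> {1..n} \<Longrightarrow> k \<in> {1..n} \<Longrightarrow> f i \<noteq> k \<Longrightarrow> B i k = 0"
    by metis
  have "inj_on f {1..n}"
  proof (rule inj_onI)
    fix i k assume ik: "i \<in> {1..n}" "k \<in> {1..n}" "f i = f k"
    have "\<exists>l\<in>{1..n}. B l (f i) = 1 \<and> (\<forall>m\<in>{1..n}. l \<noteq> m \<longrightarrow> B m (f i) = 0)"
      using sum_eq_1_iff[of "{1..n}" "\<lambda>l. B l (f i)"] colB[OF f(1)[OF ik(1)]] by blast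
    then show "i = k" using f(2) ik by (metis zero_neq_one)
  qed
  define t where "t = (\<lambda>i. if i \<in> {1..n} then f i else i)"
  have t: "t permutes {1..n}"
    unfolding t_def using f(1) \<open>inj_on f {1..n}\<close> by (intro inj_on_extend_permutes) auto
  have "A i j = perm_sum n s t i j" for i j
  proof (cases "i \<in> {1..n} \<and> j \<in> {1..n}")
    case True
    then have "B i j = of_bool (t i = j)" using f(2)[of i] f(3)[of i j] by (auto simp: t_def)
    then show ?thesis using True AB by (simp add: perm_sum_def)
  next
    case False
    then show ?thesis
      using zero[of i j] perm_sum_two_regular[OF s t] unfolding two_regular_matrices_def by auto
  qed
  with s t show ?thesis by blast
qed

section \<open>Counting the decompositions of a matrix\<close>

lemma orbit_subset_invariant:
  assumes "x \<in> S" "\<And>y. y \<in> S \<Longrightarrow> p y \<in> S"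
  shows "orbit p x \<subseteq> S"
proof
  fix y assume "y \<in> orbit p x"
  then show "y \<in> S" by induction (use assms in auto)
qed

lemma image_orbit_eq:
  assumes "p permutes U" "finite U"
  shows "p ` orbit p x = orbit p x"
proof (rule endo_inj_surj)
  show "finite (orbit p x)"
    using finite_cyclic_on[OF cyclic_on_orbit[OF assms]] .
  show "p ` orbit p x \<subseteq> orbit p x" by (auto intro: orbit.step)
  show "inj_on p (orbit p x)" using permutes_inj[OF assms(1)] by (rule inj_on_subset) auto
qed

lemma orbit_eq_of_mem:
  assumes "p permutes U" "finite U" "y \<in> orbit p x"
  shows "orbit p y = orbit p x"
  using orbit_cyclic_eq3[OF cyclic_on_orbit[OF assms(1,2)] assms(3)] .

lemma self_in_orbit:
  assumes "p permutes U" "finite U"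
  shows "x \<in> orbit p x"
  using assms by (intro permutation_self_in_orbit) (auto simp: permutation_permutes)

lemma card_orbit_eq_1_iff:
  assumes "p permutes U" "finite U"
  shows "card (orbit p x) = 1 \<longleftrightarrow> p x = x"
  using self_in_orbit[OF assms, of x] orbit_eq_singleton_iff[of p x]
  by (auto simp: card_1_singleton_iff)

text \<open>
  Invariant sets are unions of orbits, and avoiding the fixed points means using only the orbits
  with more than one point.
\<close>
lemma card_invariant_subsets:
  assumes p: "p permutes U" and U: "finite U"
  shows "card {D. D \<subseteq> {i\<in>U. p i \<noteq> i} \<and> p ` D = D} = 2 ^ card {X \<in> orbit p ` U. card X \<noteq> 1}"
proof -
  let ?O = "{X \<in> orbit p ` U. card X \<noteq> 1}"
  let ?I = "{D. D \<subseteq> {i\<in>U. p i \<noteq> i} \<and> p ` D = D}"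
  have sub: "X \<subseteq> {i\<in>U. p i \<noteq> i}" "p ` X = X" if X: "X \<in> ?O" for X
  proof -
    obtain x where x: "x \<in> U" "X = orbit p x" "card X \<noteq> 1" using X by auto
    show "X \<subseteq> {i\<in>U. p i \<noteq> i}"
    proof
      fix y assume y: "y \<in> X"
      then have "orbit p y = X" using orbit_eq_of_mem[OF p U] x by simp
      with x show "y \<in> {i\<in>U. p i \<noteq> i}"
        using card_orbit_eq_1_iff[OF p U, of y] permutes_orbit_subset[OF p x(1)] y by auto
    qed
    show "p ` X = X" using image_orbit_eq[OF p U] x(2) by simp
  qed
  have "bij_betw Union (Pow ?O) ?I"
  proof (rule bij_betw_byWitness[where f' = "\<lambda>D. {X \<in> ?O. X \<subseteq> D}"])
    show "\<forall>Q\<in>Pow ?O. {X \<in> ?O. X \<subseteq> \<Union> Q} = Q"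
    proof (intro ballI equalityI subsetI)
      fix Q X assume Q: "Q \<in> Pow ?O" and X: "X \<in> {X \<in> ?O. X \<subseteq> \<Union> Q}"
      then obtain x where x: "X = orbit p x" by blast
      then have "x \<in> X" using self_in_orbit[OF p U] by simp
      then obtain Y where Y: "Y \<in> Q" "x \<in> Y" using X by blast
      then obtain y where "Y = orbit p y" using Q by blast
      then have "X = Y" using Y(2) x orbit_eq_of_mem[OF p U] by simp
      then show "X \<in> Q" using Y by simp
    qed auto
    show "\<forall>D\<in>?I. \<Union> {X \<in> ?O. X \<subseteq> D} = D"
    proof (intro ballI equalityI subsetI)
      fix D x assume D: "D \<in> ?I" and x: "x \<in> D"
      have "orbit p x \<subseteq> D" using D x by (intro orbit_subset_invariant) auto
      moreover have "orbit p x \<in> ?O" using D x card_orbit_eq_1_iff[OF p U, of x] by auto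
      ultimately show "x \<in> \<Union> {X \<in> ?O. X \<subseteq> D}" using self_in_orbit[OF p U, of x] by blast
    qed auto
    show "Union ` Pow ?O \<subseteq> ?I"
    proof
      fix D assume "D \<in> Union ` Pow ?O"
      then obtain Q where Q: "Q \<subseteq> ?O" "D = \<Union> Q" by auto
      have "p ` D = (\<Union>X\<in>Q. p ` X)" using Q(2) by auto
      also have "\<dots> = \<Union> Q" using Q(1) sub(2) by (auto simp: subset_iff)
      finally have "p ` D = D" using Q(2) by simp
      moreover have "D \<subseteq> {i\<in>U. p i \<noteq> i}" using Q sub(1) by blast
      ultimately show "D \<in> ?I" by blast
    qed
    show "(\<lambda>D. {X \<in> ?O. X \<subseteq> D}) ` ?I \<subseteq> Pow ?O" by auto
  qed
  then have "card ?I = card (Pow ?O)" by (simp add: bij_betw_same_card)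
  then show ?thesis using U by (simp add: card_Pow)
qed

definition exchange :: "'a set \<Rightarrow> ('a \<Rightarrow> 'b) \<Rightarrow> ('a \<Rightarrow> 'b) \<Rightarrow> 'a \<Rightarrow> 'b" where
  "exchange D s t = (\<lambda>i. if i \<in> D then t i else s i)"

lemma exchange_permutes:
  assumes s: "s permutes U" and t: "t permutes U" and U: "finite U"
    and D: "D \<subseteq> U" and st: "t ` D = s ` D"
  shows "exchange D s t permutes U"
proof -
  have cross: "t i \<noteq> s k" if "i \<in> D" "k \<notin> D" for i k
    using that st permutes_inj[OF s] by (metis imageI inj_image_mem_iff)
  have "inj_on (exchange D s t) U"
  proof (rule inj_onI)
    fix i k assume ik: "exchange D s t i = exchange D s t k"
    show "i = k"
      using ik cross[of i k] cross[of k i] injD[OF permutes_inj[OF s], of i k]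
        injD[OF permutes_inj[OF t], of i k]
      by (cases "i \<in> D"; cases "k \<in> D") (simp_all add: exchange_def)
  qed
  moreover have "exchange D s t ` U \<subseteq> U"
    using permutes_in_image[OF s] permutes_in_image[OF t] by (auto simp: exchange_def)
  ultimately have "(\<lambda>i. if i \<in> U then exchange D s t i else i) permutes U"
    using U by (rule inj_on_extend_permutes)
  moreover have "(\<lambda>i. if i \<in> U then exchange D s t i else i) = exchange D s t"
    using D permutes_not_in[OF s] by (auto simp: exchange_def fun_eq_iff)
  ultimately show ?thesis by simp
qed

text \<open>
  A row of a sum of two permutation matrices determines the unordered pair of columns it came from.
\<close>
lemma of_bool_pair_eqD:
  assumes "\<And>j. of_bool (a = j) + of_bool (b = j) = (of_bool (c = j) + of_bool (d = j) :: nat)"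
  shows "a = c \<and> b = d \<or> a = d \<and> b = c"
proof (cases "a = c")
  case True
  then have "of_bool (b = b) = (of_bool (d = b) :: nat)" using assms[of b] by simp
  then have "d = b" by (cases "d = b") simp_all
  then show ?thesis using True by simp
next
  case False
  have "a = d"
  proof (rule ccontr)
    assume "a \<noteq> d"
    then show False using assms[of a] False by simp
  qed
  then have "of_bool (b = b) = (of_bool (c = b) :: nat)" using assms[of b] by simp
  then have "c = b" by (cases "c = b") simp_all
  then show ?thesis using \<open>a = d\<close> by simp
qed

lemma inv_comp_image_iff:
  assumes "s permutes U"
  shows "(inv s \<circ> t) ` D = D \<longleftrightarrow> t ` D = s ` D"
proof -
  have "inv s ` (s ` D) = D" "s ` (inv s ` (t ` D)) = t ` D"
    using permutes_inverses[OF assms] by (simp_all add: image_image)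
  then show ?thesis unfolding image_comp[symmetric] by metis
qed

text \<open>
  Another decomposition \<open>(s', t')\<close> of the same matrix agrees in each row with \<open>(s, t)\<close> up to order,
  so it arises by exchanging \<open>s\<close> and \<open>t\<close> on the set \<open>D\<close> of rows where \<open>s'\<close> and \<open>s\<close> differ. The
  result consists of bijections exactly when \<open>t ` D = s ` D\<close>, that is, when \<open>D\<close> is invariant under
  \<open>inv s \<circ> t\<close>. Requiring \<open>D\<close> to avoid the fixed points, the rows with \<open>s i = t i\<close>, makes \<open>D\<close>
  unique.
\<close>
lemma card_decompositions:
  assumes s: "s permutes {1..n}" and t: "t permutes {1..n}"
  shows "card {q \<in> {p. p permutes {1..n}} \<times> {p. p permutes {1..n}}.
            (case q of (s', t') \<Rightarrow> perm_sum n s' t') = perm_sum n s t}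
    = 2 ^ card {X \<in> orbit (inv s \<circ> t) ` {1..n}. card X \<noteq> 1}" (is "card ?F = _")
proof -
  let ?p = "inv s \<circ> t"
  let ?I = "{D. D \<subseteq> {i\<in>{1..n}. ?p i \<noteq> i} \<and> ?p ` D = D}"
  have fixp: "inv s (t i) = i \<longleftrightarrow> t i = s i" for i
    using permutes_inv_eq[OF s, of "t i" i] by auto
  have "bij_betw (\<lambda>D. (exchange D s t, exchange D t s)) ?I ?F"
  proof (rule bij_betw_byWitness[where f' = "\<lambda>q. {i\<in>{1..n}. fst q i \<noteq> s i}"])
    show "\<forall>D\<in>?I. {i \<in> {1..n}. fst (exchange D s t, exchange D t s) i \<noteq> s i} = D"
    proof
      fix D assume "D \<in> ?I"
      then have "D \<subseteq> {i\<in>{1..n}. ?p i \<noteq> i}" by blast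
      then show "{i \<in> {1..n}. fst (exchange D s t, exchange D t s) i \<noteq> s i} = D"
        by (auto simp: exchange_def fixp split: if_splits)
    qed
    have pair: "s' i = s i \<and> t' i = t i \<or> s' i = t i \<and> t' i = s i"
      if "(s', t') \<in> ?F" "i \<in> {1..n}" for s' t' i
    proof (rule of_bool_pair_eqD)
      fix j
      have "perm_sum n s' t' i j = perm_sum n s t i j" using that(1) by simp
      then show "of_bool (s' i = j) + of_bool (t' i = j) =
          (of_bool (s i = j) + of_bool (t i = j) :: nat)"
        using that(2) by (simp add: perm_sum_def)
    qed
    show "\<forall>q\<in>?F. (exchange {i \<in> {1..n}. fst q i \<noteq> s i} s t,
                    exchange {i \<in> {1..n}. fst q i \<noteq> s i} t s) = q"
    proof
      fix q assume q: "q \<in> ?F"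
      then obtain s' t' where st': "q = (s', t')" "s' permutes {1..n}" "t' permutes {1..n}" by auto
      have "exchange {i \<in> {1..n}. s' i \<noteq> s i} s t i = s' i"
           "exchange {i \<in> {1..n}. s' i \<noteq> s i} t s i = t' i" for i
      proof -
        show "exchange {i \<in> {1..n}. s' i \<noteq> s i} s t i = s' i"
          using pair[of s' t' i] q st' permutes_not_in[OF s, of i] permutes_not_in[OF st'(2), of i]
          by (cases "i \<in> {1..n}") (auto simp: exchange_def)
        show "exchange {i \<in> {1..n}. s' i \<noteq> s i} t s i = t' i"
          using pair[of s' t' i] q st' permutes_not_in[OF t, of i] permutes_not_in[OF st'(3), of i]
          by (cases "i \<in> {1..n}") (auto simp: exchange_def)
      qed
      then show "(exchange {i \<in> {1..n}. fst q i \<noteq> s i} s t,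
                  exchange {i \<in> {1..n}. fst q i \<noteq> s i} t s) = q"
        using st'(1) by (simp add: fun_eq_iff)
    qed
    show "(\<lambda>D. (exchange D s t, exchange D t s)) ` ?I \<subseteq> ?F"
    proof (rule image_subsetI)
      fix D assume "D \<in> ?I"
      then have D: "D \<subseteq> {1..n}" "t ` D = s ` D" using inv_comp_image_iff[OF s] by auto
      have "exchange D s t permutes {1..n}" "exchange D t s permutes {1..n}"
        using D s t by (auto intro!: exchange_permutes)
      moreover have "perm_sum n (exchange D s t) (exchange D t s) = perm_sum n s t"
        by (auto simp: fun_eq_iff perm_sum_def exchange_def)
      ultimately show "(exchange D s t, exchange D t s) \<in> ?F" by simp
    qed
    show "(\<lambda>q. {i\<in>{1..n}. fst q i \<noteq> s i}) ` ?F \<subseteq> ?I"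
    proof (rule image_subsetI)
      fix q assume q: "q \<in> ?F"
      then obtain s' t' where st': "q = (s', t')" "s' permutes {1..n}" by auto
      let ?D = "{i\<in>{1..n}. s' i \<noteq> s i}"
      have on: "s' i = t i" if "i \<in> ?D" for i using pair[of s' t' i] q st' that by auto
      \<comment> \<open>\<open>s'\<close> and \<open>s\<close> have the same image and agree off \<open>?D\<close>, hence have the same image of \<open>?D\<close>\<close>
      have "t ` ?D = s' ` ?D" using on by (intro image_cong) auto
      also have "\<dots> = s' ` ({1..n} - ({1..n} - ?D))" by (intro arg_cong[where f = "image s'"]) auto
      also have "\<dots> = {1..n} - s' ` ({1..n} - ?D)"
        using permutes_image[OF st'(2)] permutes_inj[OF st'(2)] by (simp add: image_set_diff)
      also have "s' ` ({1..n} - ?D) = s ` ({1..n} - ?D)" by (intro image_cong) auto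
      also have "{1..n} - s ` ({1..n} - ?D) = s ` ({1..n} - ({1..n} - ?D))"
        using permutes_image[OF s] permutes_inj[OF s] by (simp add: image_set_diff)
      also have "\<dots> = s ` ?D" by (intro arg_cong[where f = "image s"]) auto
      finally have "?p ` ?D = ?D" by (simp only: inv_comp_image_iff[OF s])
      moreover have "?D \<subseteq> {i\<in>{1..n}. ?p i \<noteq> i}" using on fixp by auto
      ultimately show "{i\<in>{1..n}. fst q i \<noteq> s i} \<in> ?I"
        unfolding st'(1) fst_conv by blast
    qed
  qed
  then have "card ?F = card ?I" by (simp add: bij_betw_same_card)
  also have "\<dots> = 2 ^ card {X \<in> orbit ?p ` {1..n}. card X \<noteq> 1}"
    using permutes_compose[OF t permutes_inv[OF s]] by (rule card_invariant_subsets) simp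
  finally show ?thesis .
qed

lemma cycle_weight_eq:
  assumes p: "p permutes {1..n}"
  shows "cycle_weight n p = 1 / 2 ^ card {X \<in> orbit p ` {1..n}. card X \<noteq> 1}"
proof -
  let ?O = "orbit p ` {1..n}"
  have "card X \<in> {1..n}" if X: "X \<in> ?O" for X
  proof -
    obtain x where x: "x \<in> {1..n}" "X = orbit p x" using X by blast
    then have "X \<subseteq> {1..n}" using permutes_orbit_subset[OF p] by simp
    then have "card X \<le> n" using card_mono[of "{1..n}" X] by simp
    moreover have "finite X" using \<open>X \<subseteq> {1..n}\<close> by (rule finite_subset) simp
    moreover have "X \<noteq> {}" using x orbit_nonempty by simp
    ultimately show ?thesis using card_gt_0_iff[of X] by simp
  qed
  then have "card ?O = (\<Sum>i\<in>{1..n}. card {X \<in> ?O. card X = i})"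
    using sum.group[of ?O "{1..n}" card "\<lambda>_. 1::nat"] by (simp add: image_subset_iff)
  then have total: "total_cycles n p = card ?O"
    by (simp add: total_cycles_def cycle_count_def)
  have "card ?O = card ({X \<in> ?O. card X = 1} \<union> {X \<in> ?O. card X \<noteq> 1})"
    by (rule arg_cong[where f = card]) auto
  also have "\<dots> = cycle_count n 1 p + card {X \<in> ?O. card X \<noteq> 1}"
    unfolding cycle_count_def by (rule card_Un_disjoint) auto
  finally have exponent: "- int (total_cycles n p) + int (cycle_count n 1 p)
      = - int (card {X \<in> ?O. card X \<noteq> 1})" using total by simp
  show ?thesis
    unfolding cycle_weight_def exponent by (simp add: power_int_minus inverse_eq_divide)
qed

section \<open>Components are cycles\<close>

text \<open>
  A row sum of \<open>2\<close> inside \<open>T\<close> says that both columns of that row lie in \<open>T\<close>. As \<open>S\<close> and \<open>T\<close> have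
  the same size, \<open>s\<close> and \<open>t\<close> both map \<open>S\<close> onto \<open>T\<close>, so \<open>T\<close> is determined by \<open>S\<close>, and \<open>S\<close> is
  invariant under \<open>inv s \<circ> t\<close>.
\<close>
lemma k_component_perm_sum_iff:
  assumes s: "s permutes {1..n}" and t: "t permutes {1..n}"
  shows "k_component n (perm_sum n s t) k (S, T) \<longleftrightarrow>
    S \<noteq> {} \<and> S \<subseteq> {1..n} \<and> card S = k \<and> T = s ` S \<and> (inv s \<circ> t) ` S = S"
    (is "?L \<longleftrightarrow> ?R")
proof
  assume L: ?L
  then have S: "S \<noteq> {}" "S \<subseteq> {1..n}" "card S = k" and T: "T \<subseteq> {1..n}" "card T = k"
    and row: "\<And>i. i \<in> S \<Longrightarrow> (\<Sum>j\<in>T. perm_sum n s t i j) = 2"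
    by (auto simp: k_component_def)
  have finT: "finite T" using T(1) by (rule finite_subset) simp
  have "s i \<in> T \<and> t i \<in> T" if "i \<in> S" for i
  proof -
    have "i \<in> {1..n}" using that S(2) by blast
    then have "of_bool (s i \<in> T) + of_bool (t i \<in> T) = (2 :: nat)"
      using row[OF that] perm_sum_row[OF _ finT, of i n s t] by simp
    then show ?thesis by (cases "s i \<in> T"; cases "t i \<in> T") simp_all
  qed
  then have sub: "s ` S \<subseteq> T" "t ` S \<subseteq> T" by auto
  have "card (s ` S) = card T" "card (t ` S) = card T"
    using S(3) T(2) permutes_inj_on[OF s] permutes_inj_on[OF t] by (simp_all add: card_image)
  then have "s ` S = T" "t ` S = T" using sub finT by (simp_all add: card_subset_eq)
  moreover from this have "(inv s \<circ> t) ` S = S" by (simp only: inv_comp_image_iff[OF s])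
  ultimately show ?R using S by blast
next
  assume R: ?R
  then have ts: "t ` S = s ` S" by (simp only: inv_comp_image_iff[OF s])
  have S: "S \<subseteq> {1..n}" using R by blast
  then have "finite (s ` S)" by (auto intro: finite_subset)
  have "s ` S \<subseteq> {1..n}" using S permutes_in_image[OF s] by blast
  moreover have "card (s ` S) = k" using R permutes_inj_on[OF s] by (simp add: card_image)
  moreover have "(\<Sum>j\<in>s ` S. perm_sum n s t i j) = 2" if "i \<in> S" for i
  proof -
    have "t i \<in> s ` S" using that ts by blast
    then show ?thesis using that S \<open>finite (s ` S)\<close> by (subst perm_sum_row) auto
  qed
  moreover have "(\<Sum>i\<in>S. perm_sum n s t i j) = 2" if "j \<in> s ` S" for j
    using that ts perm_sum_column[OF s t S, of j] by simp
  ultimately show ?L using R by (auto simp: k_component_def)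
qed

text \<open>
  The minimal non-empty invariant sets of a permutation are its orbits.
\<close>
lemma irreducible_perm_sum_iff:
  assumes s: "s permutes {1..n}" and t: "t permutes {1..n}"
  shows "irreducible_k_component n (perm_sum n s t) k (S, T) \<longleftrightarrow>
    S \<in> orbit (inv s \<circ> t) ` {1..n} \<and> card S = k \<and> T = s ` S" (is "?L \<longleftrightarrow> ?R")
proof -
  let ?p = "inv s \<circ> t"
  have p: "?p permutes {1..n}" using permutes_compose[OF t permutes_inv[OF s]] .
  have img: "?p ` orbit ?p x = orbit ?p x" for x using image_orbit_eq[OF p] by simp
  note comp = k_component_perm_sum_iff[OF s t]
  show ?thesis
  proof
    assume L: ?L
    then have S: "S \<noteq> {}" "S \<subseteq> {1..n}" "card S = k" "T = s ` S" "?p ` S = S"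
      using comp by (auto simp: irreducible_k_component_def)
    then obtain x where x: "x \<in> S" "x \<in> {1..n}" by blast
    have sub: "orbit ?p x \<subseteq> S" using x S(5) by (intro orbit_subset_invariant) auto
    then have "k_component n (perm_sum n s t) (card (orbit ?p x)) (orbit ?p x, s ` orbit ?p x)"
      using S(2) orbit_nonempty[of ?p x] img by (simp add: comp)
    then have "orbit ?p x = S"
      using L sub S(4) unfolding irreducible_k_component_def by (auto dest: image_mono)
    then show ?R using x S by auto
  next
    assume R: ?R
    then obtain x where x: "x \<in> {1..n}" "S = orbit ?p x" by blast
    have "k_component n (perm_sum n s t) k (S, T)"
      using R x img permutes_orbit_subset[OF p x(1)] orbit_nonempty[of ?p x] by (simp add: comp)
    moreover have "(S', T') = (S, T)"
      if "k_component n (perm_sum n s t) l (S', T')" "S' \<subseteq> S" for l S' T'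
    proof -
      have S': "S' \<noteq> {}" "T' = s ` S'" "?p ` S' = S'" using that(1) by (auto simp: comp)
      then obtain y where y: "y \<in> S'" by blast
      then have "orbit ?p y \<subseteq> S'" using S'(3) by (intro orbit_subset_invariant) auto
      moreover have "orbit ?p y = S"
        using orbit_eq_of_mem[OF p _, of y x] y that(2) x(2) by auto
      ultimately have "S' = S" using that(2) by simp
      then show ?thesis using S'(2) R by simp
    qed
    ultimately show ?L unfolding irreducible_k_component_def by blast
  qed
qed

lemma chi_perm_sum:
  assumes s: "s permutes {1..n}" and t: "t permutes {1..n}"
  shows "chi n k (perm_sum n s t) = cycle_count n k (inv s \<circ> t)"
proof -
  have "{P. irreducible_k_component n (perm_sum n s t) k P}
      = (\<lambda>X. (X, s ` X)) ` {X \<in> orbit (inv s \<circ> t) ` {1..n}. card X = k}"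
    using irreducible_perm_sum_iff[OF s t] by (auto simp: image_iff)
  moreover have "inj_on (\<lambda>X. (X, s ` X)) {X \<in> orbit (inv s \<circ> t) ` {1..n}. card X = k}"
    by (auto simp: inj_on_def)
  ultimately show ?thesis by (simp add: chi_def cycle_count_def card_image)
qed

section \<open>Transfer of sums\<close>

text \<open>
  Both sides equal the sum over all pairs \<open>(s, t)\<close> of the weighted value at \<open>inv s \<circ> t\<close>: grouped by
  the matrix, each fibre contributes the value once, because the weight is one over the size of the
  fibre; grouped by \<open>s\<close>, each of the \<open>n!\<close> inner sums runs over the whole symmetric group.
\<close>
lemma sum_two_regular_matrices:
  fixes g :: "(nat \<Rightarrow> nat) \<Rightarrow> real"
  shows "(\<Sum>A\<in>two_regular_matrices n. g (\<lambda>k\<in>{1..n}. chi n k A)) =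
    fact n * (\<Sum>p | p permutes {1..n}. g (\<lambda>i\<in>{1..n}. cycle_count n i p) * cycle_weight n p)"
proof -
  let ?P = "{p. p permutes {1..n}}" and ?M = "two_regular_matrices n"
  let ?c = "\<lambda>A. \<lambda>k\<in>{1..n}. chi n k A"
  let ?G = "\<lambda>p. g (\<lambda>i\<in>{1..n}. cycle_count n i p) * cycle_weight n p"
  let ?f = "\<lambda>(s, t). perm_sum n s t"
  let ?w = "\<lambda>(s, t). ?G (inv s \<circ> t)"
  have fin: "finite ?P" by (rule finite_permutations_1n)
  have fibre: "(\<Sum>q\<in>{q \<in> ?P \<times> ?P. ?f q = A}. ?w q) = g (?c A)" if A: "A \<in> ?M" for A
  proof -
    let ?F = "{q \<in> ?P \<times> ?P. ?f q = A}"
    obtain s t where st: "s \<in> ?P" "t \<in> ?P" "A = perm_sum n s t"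
      using two_regular_is_perm_sum[OF A] by blast
    have "?w q = g (?c A) / card ?F" if q: "q \<in> ?F" for q
    proof -
      obtain u v where uv: "q = (u, v)" "u permutes {1..n}" "v permutes {1..n}"
          "A = perm_sum n u v" using q by auto
      have "(\<lambda>i\<in>{1..n}. cycle_count n i (inv u \<circ> v)) = ?c A"
        using chi_perm_sum[OF uv(2,3)] uv(4) by simp
      moreover have "cycle_weight n (inv u \<circ> v) = 1 / card ?F"
        using cycle_weight_eq[OF permutes_compose[OF uv(3) permutes_inv[OF uv(2)]]]
          card_decompositions[OF uv(2,3)] uv(4) by simp
      ultimately show ?thesis using uv(1) by simp
    qed
    then have "(\<Sum>q\<in>?F. ?w q) = card ?F * (g (?c A) / card ?F)" by simp
    moreover have "card ?F \<noteq> 0"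
    proof -
      have "finite ?F" using fin by (auto intro: finite_subset[of _ "?P \<times> ?P"])
      moreover have "(s, t) \<in> ?F" using st by auto
      ultimately show ?thesis by auto
    qed
    ultimately show ?thesis by simp
  qed
  have "(\<Sum>A\<in>?M. g (?c A)) = (\<Sum>A\<in>?M. \<Sum>q\<in>{q \<in> ?P \<times> ?P. ?f q = A}. ?w q)"
    using fibre by simp
  also have "\<dots> = (\<Sum>q\<in>?P \<times> ?P. ?w q)"
    using fin finite_two_regular_matrices perm_sum_two_regular by (intro sum.group) auto
  also have "\<dots> = (\<Sum>s\<in>?P. \<Sum>t\<in>?P. ?G (inv s \<circ> t))"
    by (simp add: sum.cartesian_product)
  also have "\<dots> = (\<Sum>s\<in>?P. \<Sum>p\<in>?P. ?G p)"
  proof (rule sum.cong[OF refl])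
    fix s assume "s \<in> ?P"
    then have "inv s permutes {1..n}" by (simp add: permutes_inv)
    then show "(\<Sum>t\<in>?P. ?G (inv s \<circ> t)) = (\<Sum>p\<in>?P. ?G p)"
      using setum_permutations_compose_left[of "inv s" "{1..n}" ?G] by simp
  qed
  also have "\<dots> = fact n * (\<Sum>p\<in>?P. ?G p)"
    using card_permutations[of "{1..n}" n] by simp
  finally show ?thesis .
qed

theorem mainTheorem5:
  fixes n :: nat
    and h :: "(nat \<Rightarrow> nat \<Rightarrow> nat) \<Rightarrow> real"
    and hstar :: "(nat \<Rightarrow> nat) \<Rightarrow> real"
  assumes "n \<ge> 1"
    and "\<forall>A\<in>two_regular_matrices n. h A = hstar (\<lambda>k\<in>{1..n}. chi n k A)"
  shows "measure_pmf.expectation (uniform_matrix n) h =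
           (fact n)\<^sup>2 / real (H2 n) *
           measure_pmf.expectation (uniform_permutation n)
             (\<lambda>p. hstar (\<lambda>i\<in>{1..n}. cycle_count n i p) * cycle_weight n p)
    \<and> measure_pmf.expectation (uniform_permutation n) (cycle_weight n) =
           real (H2 n) / (fact n)\<^sup>2
    \<and> measure_pmf.expectation (uniform_matrix n) h =
           measure_pmf.expectation (uniform_permutation n)
             (\<lambda>p. hstar (\<lambda>i\<in>{1..n}. cycle_count n i p) * cycle_weight n p) /
           measure_pmf.expectation (uniform_permutation n) (cycle_weight n)"
proof -
  let ?P = "{p. p permutes {1..n}}" and ?M = "two_regular_matrices n"
  let ?G = "\<lambda>p. hstar (\<lambda>i\<in>{1..n}. cycle_count n i p) * cycle_weight n p"
  have cardP: "card ?P = fact n" using card_permutations[of "{1..n}" n] by simp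
  have H: "real (H2 n) > 0"
    using finite_two_regular_matrices two_regular_matrices_nonempty
    by (simp add: H2_def card_gt_0_iff)
  have EP: "measure_pmf.expectation (uniform_permutation n) f = (\<Sum>p\<in>?P. f p) / fact n"
    for f :: "(nat \<Rightarrow> nat) \<Rightarrow> real"
    unfolding uniform_permutation_def
    using integral_pmf_of_set[OF permutations_1n_nonempty finite_permutations_1n, of n f] cardP by simp
  have EM: "measure_pmf.expectation (uniform_matrix n) h = (\<Sum>A\<in>?M. h A) / H2 n"
    unfolding uniform_matrix_def H2_def
    by (rule integral_pmf_of_set[OF two_regular_matrices_nonempty finite_two_regular_matrices])
  have "(\<Sum>A\<in>?M. h A) = fact n * (\<Sum>p\<in>?P. ?G p)"
    using assms(2) sum_two_regular_matrices[where g = hstar] by simp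
  then have 1: "measure_pmf.expectation (uniform_matrix n) h =
      (fact n)\<^sup>2 / real (H2 n) * measure_pmf.expectation (uniform_permutation n) ?G"
    using EM EP[of ?G] by (simp add: power2_eq_square)
  \<comment> \<open>the constant function 1 turns the sum over matrices into their number\<close>
  have "real (H2 n) = fact n * (\<Sum>p\<in>?P. cycle_weight n p)"
    using sum_two_regular_matrices[of "\<lambda>_. 1" n] by (simp add: H2_def)
  then have 2: "measure_pmf.expectation (uniform_permutation n) (cycle_weight n) =
      real (H2 n) / (fact n)\<^sup>2"
    using EP[of "cycle_weight n"] by (simp add: power2_eq_square)
  show ?thesis using 1 2 by simp
qed

end
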